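(* For every integer $n\ge 1$, $$E_{2n}=\sum_{k=1}^{n}k!\sum_{r=0}^{k}\frac{(-1)^r}{2^r\,r!}\sum_{j=0}^{k-r}\frac{(-1)^j(r-j)^{2n}}{2^j\,j!\,(k-r-j)!}.$$
   Context: The Euler numbers $E_m$ are defined by $\frac{1}{\cosh t}=\sum_{m=0}^\infty E_m\frac{t^m}{m!}$ for $|t|<\pi/2$ (so $E_0=1$, $E_2=-1$, $E_4=5$, and odd-index Euler numbers vanish). *)

theory Defs
  imports "HOL-Complex_Analysis.Complex_Analysis"
begin

definition euler_number :: "nat \<Rightarrow> real" where
  "euler_number = (THE E. \<forall>t::real. \<bar>t\<bar> < pi / 2 \<longrightarrow>
      (\<lambda>m. E m * (t ^ m / fact m)) sums (1 / cosh t))"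

lemma cosh_complex_nonzero:
  assumes "norm (z::complex) < pi / 2"
  shows "cosh z \<noteq> 0"
proof
  assume "cosh z = 0"
  then have "cos (\<i> * z) = 0"
    by (simp add: cosh_conv_cos)
  then obtain n :: int where n: "\<i> * z = of_int n * pi + pi / 2"
    by (auto simp: cos_eq_0)
  have "\<i> * z = complex_of_real ((of_int n + 1 / 2) * pi)"
    unfolding n by (simp add: algebra_simps)
  then have "norm (\<i> * z) = \<bar>(of_int n + 1 / 2) * pi\<bar>"
    by (simp only: norm_of_real)
  then have "norm z = \<bar>of_int n + 1 / 2 :: real\<bar> * pi"
    by (simp add: norm_mult abs_mult)
  moreover have "\<bar>of_int n + 1 / 2 :: real\<bar> \<ge> 1 / 2"
  proof (cases "n \<ge> 0")
    case False
    then have "of_int n \<le> (-1 :: real)" by linarith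
    then show ?thesis by linarith
  qed auto
  then have "\<bar>of_int n + 1 / 2 :: real\<bar> * pi \<ge> 1 / 2 * pi"
    by (intro mult_right_mono) auto
  ultimately show False using assms by simp
qed

lemma euler_number_ex:
  "\<exists>E. \<forall>t::real. \<bar>t\<bar> < pi / 2 \<longrightarrow> (\<lambda>m. E m * (t ^ m / fact m)) sums (1 / cosh t)"
proof -
  define f where "f = (\<lambda>z::complex. 1 / cosh z)"
  have hol: "f holomorphic_on ball 0 (pi / 2)"
  proof -
    have "cosh holomorphic_on ball (0::complex) (pi / 2)"
      unfolding cosh_field_def by (intro holomorphic_intros) auto
    then show ?thesis
      unfolding f_def by (intro holomorphic_intros) (auto simp: cosh_complex_nonzero)
  qed
  define E where "E = (\<lambda>m. Re ((deriv ^^ m) f 0))"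
  have "(\<lambda>m. E m * (t ^ m / fact m)) sums (1 / cosh t)" if "\<bar>t\<bar> < pi / 2" for t :: real
  proof -
    have "(\<lambda>m. (deriv ^^ m) f 0 / fact m * (of_real t - 0) ^ m) sums f (of_real t)"
      using that by (intro holomorphic_power_series[OF hol]) auto
    then have "(\<lambda>m. Re ((deriv ^^ m) f 0 / fact m * (of_real t - 0) ^ m)) sums Re (f (of_real t))"
      by (rule sums_Re)
    moreover have "Re ((deriv ^^ m) f 0 / fact m * (of_real t - 0) ^ m) = E m * (t ^ m / fact m)" for m
    proof -
      have "(deriv ^^ m) f 0 / fact m * (of_real t - 0) ^ m = (t ^ m / fact m) *\<^sub>R (deriv ^^ m) f 0"
        by (simp add: scaleR_conv_of_real)
      then show ?thesis unfolding E_def by (simp only: scaleR_complex.sel mult.commute)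
    qed
    moreover have "f (of_real t) = of_real (1 / cosh t)"
      by (simp add: f_def cosh_def scaleR_conv_of_real flip: exp_of_real of_real_minus)
    ultimately show ?thesis by simp
  qed
  then show ?thesis by blast
qed

lemma euler_number_unique:
  fixes E F :: "nat \<Rightarrow> real"
  assumes "\<forall>t::real. \<bar>t\<bar> < pi / 2 \<longrightarrow> (\<lambda>m. E m * (t ^ m / fact m)) sums (1 / cosh t)"
    and "\<forall>t::real. \<bar>t\<bar> < pi / 2 \<longrightarrow> (\<lambda>m. F m * (t ^ m / fact m)) sums (1 / cosh t)"
  shows "E = F"
proof (rule ccontr)
  assume "E \<noteq> F"
  define a where "a = (\<lambda>m. (E m - F m) / fact m)"
  obtain m where m: "a m \<noteq> 0"
    using \<open>E \<noteq> F\<close> by (auto simp: a_def fun_eq_iff)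
  have a: "(\<lambda>m. a m * (t - 0) ^ m) sums 0" if "norm (t - 0) < pi / 2" for t :: real
    using sums_diff[OF assms(1)[rule_format, of t] assms(2)[rule_format, of t]] that
    by (simp add: a_def diff_divide_distrib left_diff_distrib)
  have m0: "m > 0"
  proof (rule ccontr)
    assume "\<not> m > 0"
    moreover have "(\<lambda>m. a m * 0 ^ m) sums 0" using a[of 0] by simp
    ultimately show False using m sums_unique2 powser_sums_zero[of a] by auto
  qed
  obtain s :: real where "s > 0" and s: "\<And>z::real. z \<in> cball 0 s - {0} \<Longrightarrow> (0::real) \<noteq> 0"
    by (rule powser_0_nonzero[of "pi / 2" "0::real" a "\<lambda>_. 0" m]) (use a m m0 in auto)
  have "s \<in> cball 0 s - {0}" using \<open>s > 0\<close> by simp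
  then show False using s by blast
qed

lemma euler_number_sums:
  fixes t :: real
  assumes "\<bar>t\<bar> < pi / 2"
  shows "(\<lambda>m. euler_number m * (t ^ m / fact m)) sums (1 / cosh t)"
proof -
  have "\<exists>!E. \<forall>t::real. \<bar>t\<bar> < pi / 2 \<longrightarrow> (\<lambda>m. E m * (t ^ m / fact m)) sums (1 / cosh t)"
    using euler_number_ex euler_number_unique by blast
  from theI'[OF this] show ?thesis
    unfolding euler_number_def using assms by blast
qed

end

theory Submission
  imports Defs
begin

text \<open>
  Write \<open>C\<close> for the power series of \<open>cosh\<close> and \<open>E\<close> for the exponential generating
  function of the Euler numbers, so that \<open>E = 1 / C\<close>. Since \<open>1 - C\<close> has no constant term,
  \<open>E\<close> is the geometric series \<open>\<Sum>k. (1 - C) ^ k\<close>. As \<open>cosh\<close> is even, \<open>1 - C\<close> even vanishes to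
  order 2, hence the \<open>2 * n\<close>-th coefficient sees only the terms with \<open>k \<le> n\<close>; the term
  \<open>k = 0\<close> drops out because \<open>n \<ge> 1\<close>.

  Multiplied by \<open>k!\<close>, the sum over \<open>r\<close> and \<open>j\<close> in the claim is the coefficient of
  \<open>t ^ (2 * n) / (2 * n)!\<close> in \<open>(1 - C) ^ k\<close>: expanding powers of the trinomial
  \<open>1 - exp t / 2 - exp (-t) / 2\<close> yields multiples of \<open>exp ((r - j) * t)\<close>
  (lemma \<open>nth_one_minus_cosh_power\<close>), whose \<open>m\<close>-th derivative at \<open>0\<close> is \<open>(r - j) ^ m\<close>.

  The Euler numbers are given by an analytic identity on \<open>\<bar>t\<bar> < pi / 2\<close>, whereas the argument
  above is one of formal power series; \<open>euler_egf_times_cosh\<close> passes from one to the other.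
\<close>

definition fps_cosh :: "real fps" where
  "fps_cosh = fps_const (1/2) * (fps_exp 1 + fps_exp (-1))"

definition euler_egf :: "real fps" where
  "euler_egf = Abs_fps (\<lambda>m. euler_number m / fact m)"

lemma fps_cosh_conv_radius: "fps_conv_radius fps_cosh = \<infinity>"
  unfolding fps_cosh_def
  using fps_conv_radius_mult[of "fps_const (1/2 :: real)" "fps_exp 1 + fps_exp (-1)"]
    fps_conv_radius_add[of "fps_exp (1::real)" "fps_exp (-1)"] by simp

lemma eval_fps_cosh: "eval_fps fps_cosh t = cosh t"
proof -
  have "fps_conv_radius (fps_exp 1 + fps_exp (-1) :: real fps) = \<infinity>"
    using fps_conv_radius_add[of "fps_exp (1::real)" "fps_exp (-1)"] by simp
  then show ?thesis
    by (simp add: fps_cosh_def eval_fps_mult eval_fps_add cosh_def)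
qed

lemma euler_egf_sums:
  assumes "\<bar>t\<bar> < pi / 2"
  shows "(\<lambda>m. fps_nth euler_egf m * t ^ m) sums (1 / cosh t)"
  using euler_number_sums[OF assms] by (simp add: euler_egf_def)

lemma euler_egf_conv_radius: "fps_conv_radius euler_egf \<ge> ereal (pi / 2)"
  unfolding fps_conv_radius_def
proof (rule conv_radius_geI_ex')
  fix r :: real
  assume "0 < r" "ereal r < ereal (pi / 2)"
  then show "summable (\<lambda>m. fps_nth euler_egf m * of_real r ^ m)"
    using euler_egf_sums[of r] by (simp add: sums_iff)
qed

text \<open>
  Analytically \<open>E * C - 1\<close> is the zero function near \<open>0\<close>. Adding its coefficients to the
  Euler numbers thus gives another expansion of \<open>1 / cosh\<close>, and the uniqueness of the latter,
  which already underlies the definition of the Euler numbers, forces \<open>E * C - 1 = 0\<close>.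
\<close>
lemma euler_egf_times_cosh: "euler_egf * fps_cosh = 1"
proof -
  define P where "P = euler_egf * fps_cosh - 1"
  have P0: "(\<lambda>m. fps_nth P m * t ^ m) sums 0" if t: "\<bar>t\<bar> < pi / 2" for t :: real
  proof -
    have t': "ereal (norm t) < fps_conv_radius euler_egf"
      using t by (intro less_le_trans[OF _ euler_egf_conv_radius]) simp
    have prod: "ereal (norm t) < fps_conv_radius (euler_egf * fps_cosh)"
      by (rule less_le_trans[OF _ fps_conv_radius_mult]) (simp add: fps_cosh_conv_radius t' del: real_norm_def)
    have P: "ereal (norm t) < fps_conv_radius P"
      unfolding P_def
      by (rule less_le_trans[OF _ fps_conv_radius_diff]) (simp add: prod del: real_norm_def)
    have "eval_fps euler_egf t = 1 / cosh t"
      using euler_egf_sums[OF t] by (simp add: eval_fps_def sums_iff)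
    then have "eval_fps P t = 0"
      using t' prod cosh_real_pos[of t]
      by (simp add: P_def eval_fps_diff eval_fps_mult fps_cosh_conv_radius eval_fps_cosh)
    then show ?thesis
      using sums_eval_fps[OF P] by simp
  qed
  have "euler_number = (\<lambda>m. euler_number m + fact m * fps_nth P m)"
  proof (rule euler_number_unique; intro allI impI)
    fix t :: real
    assume t: "\<bar>t\<bar> < pi / 2"
    show "(\<lambda>m. euler_number m * (t ^ m / fact m)) sums (1 / cosh t)"
      by (rule euler_number_sums[OF t])
    then have "(\<lambda>m. euler_number m * (t ^ m / fact m) + fps_nth P m * t ^ m) sums (1 / cosh t + 0)"
      using P0[OF t] by (rule sums_add)
    then show "(\<lambda>m. (euler_number m + fact m * fps_nth P m) * (t ^ m / fact m)) sums (1 / cosh t)"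
      by (simp add: algebra_simps)
  qed
  then have "fps_nth P m = 0" for m
    by (metis add_cancel_right_right fact_nonzero mult_eq_0_iff)
  then have "P = 0"
    by (intro fps_ext) simp
  then show ?thesis
    by (simp add: P_def)
qed

text \<open>
  The geometric series with an exact remainder makes any notion of infinite sum of power
  series unnecessary: the remainder is removed later by its order of vanishing.
\<close>
lemma inverse_geometric:
  fixes e c :: "'a :: comm_ring_1"
  assumes "e * c = 1"
  shows "e = (\<Sum>k\<le>n. (1 - c) ^ k) + e * (1 - c) ^ Suc n"
proof -
  have "c * (\<Sum>k\<le>n. (1 - c) ^ k) = 1 - (1 - c) ^ Suc n"
    using sum_gp_basic[of "1 - c" n] by simp
  then have "(e * c) * (\<Sum>k\<le>n. (1 - c) ^ k) = e - e * (1 - c) ^ Suc n"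
    by (simp add: mult.assoc right_diff_distrib)
  then show ?thesis
    by (simp only: assms mult_1_left diff_add_cancel)
qed

lemma subdegree_one_minus_cosh: "1 - fps_cosh \<noteq> 0" "subdegree (1 - fps_cosh) = 2"
proof -
  have 2: "fps_nth (1 - fps_cosh) 2 = - 1 / 2"
    by (simp add: fps_cosh_def)
  have "fps_nth (1 - fps_cosh) i = 0" if "i < 2" for i
    using that by (auto simp: fps_cosh_def less_2_cases_iff)
  with 2 show "subdegree (1 - fps_cosh) = 2"
    by (intro subdegreeI) auto
  from 2 show "1 - fps_cosh \<noteq> 0" by auto
qed

text \<open>
  The trinomial theorem, obtained by applying the binomial theorem twice to the grouping
  \<open>x + (y + 1)\<close> with \<open>x = - exp t / 2\<close> and \<open>y = - exp (-t) / 2\<close>. This nesting is what makes the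
  inner sum run up to \<open>k - r\<close>, and the product of the two binomial coefficients telescopes to
  \<open>k! / (r! * j! * (k - r - j)!)\<close>.
\<close>
lemma nth_one_minus_cosh_power:
  "fps_nth ((1 - fps_cosh) ^ k) m * fact m = fact k *
      (\<Sum>r = 0..k. (-1) ^ r / (2 ^ r * fact r) *
        (\<Sum>j = 0..k - r. (-1) ^ j * (real r - real j) ^ m /
            (2 ^ j * fact j * fact (k - r - j))))"
proof -
  define h :: "real fps" where "h = fps_const (- 1 / 2)"
  have summand: "(h * fps_exp 1) ^ r * (h * fps_exp (-1)) ^ j
      = fps_const ((- 1 / 2) ^ (r + j)) * fps_exp (real r - real j)" for r j
  proof -
    have "(h * fps_exp 1) ^ r * (h * fps_exp (-1)) ^ j
        = h ^ (r + j) * (fps_exp (real r) * fps_exp (- real j))"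
      by (simp add: power_mult_distrib fps_exp_power_mult power_add mult_ac)
    also have "\<dots> = fps_const ((- 1 / 2) ^ (r + j)) * fps_exp (real r - real j)"
      by (simp only: h_def fps_const_power flip: fps_exp_add_mult) simp
    finally show ?thesis .
  qed
  have "1 - fps_cosh = h * fps_exp 1 + (h * fps_exp (-1) + 1)"
    by (simp add: fps_eq_iff fps_cosh_def h_def field_simps)
  then have "(1 - fps_cosh) ^ k = (\<Sum>r\<le>k. of_nat (k choose r) * (h * fps_exp 1) ^ r *
      (\<Sum>j\<le>k - r. of_nat (k - r choose j) * (h * fps_exp (-1)) ^ j))"
    by (simp only: binomial_ring) (simp)
  also have "\<dots> = (\<Sum>r\<le>k. \<Sum>j\<le>k - r. fps_const (real (k choose r) * real (k - r choose j)
      * (- 1 / 2) ^ (r + j)) * fps_exp (real r - real j))"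
    unfolding sum_distrib_left
  proof (intro sum.cong refl)
    fix r j
    have "of_nat (k choose r) * (h * fps_exp 1) ^ r * (of_nat (k - r choose j) * (h * fps_exp (-1)) ^ j)
      = of_nat (k choose r) * of_nat (k - r choose j) * ((h * fps_exp 1) ^ r * (h * fps_exp (-1)) ^ j)"
      by (simp only: mult_ac)
    also have "\<dots> = fps_const (real (k choose r) * real (k - r choose j)
      * (- 1 / 2) ^ (r + j)) * fps_exp (real r - real j)"
      unfolding summand by (simp only: fps_of_nat[symmetric] mult.assoc[symmetric] fps_const_mult)
    finally show "of_nat (k choose r) * (h * fps_exp 1) ^ r * (of_nat (k - r choose j) * (h * fps_exp (-1)) ^ j) = fps_const (real (k choose r) * real (k - r choose j)
      * (- 1 / 2) ^ (r + j)) * fps_exp (real r - real j)" .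
  qed
  finally have "fps_nth ((1 - fps_cosh) ^ k) m * fact m = (\<Sum>r\<le>k. \<Sum>j\<le>k - r.
      real (k choose r) * real (k - r choose j) * (- 1 / 2) ^ (r + j) * (real r - real j) ^ m)"
    by (simp add: fps_sum_nth sum_distrib_right)
  also have "\<dots> = (\<Sum>r\<le>k. \<Sum>j\<le>k - r. fact k * ((-1) ^ r / (2 ^ r * fact r) *
        ((-1) ^ j * (real r - real j) ^ m / (2 ^ j * fact j * fact (k - r - j)))))"
    unfolding power_add power_divide
    by (intro sum.cong refl) (simp add: binomial_fact field_simps)
  finally show ?thesis
    by (simp add: sum_distrib_left atMost_atLeast0)
qed

theorem mainTheorem8:
  fixes n :: nat
  assumes "n \<ge> 1"
  shows "euler_number (2 * n) =
    (\<Sum>k = 1..n. fact k *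
      (\<Sum>r = 0..k. (-1) ^ r / (2 ^ r * fact r) *
        (\<Sum>j = 0..k - r. (-1) ^ j * (real r - real j) ^ (2 * n) /
            (2 ^ j * fact j * fact (k - r - j)))))"
proof -
  \<comment> \<open>the remainder of the geometric series vanishes to order \<open>2 * n + 2\<close>\<close>
  have "subdegree euler_egf + 2 * Suc n \<le> subdegree (euler_egf * (1 - fps_cosh) ^ Suc n)"
    using euler_egf_times_cosh subdegree_one_minus_cosh
    by (subst subdegree_mult) (auto simp: mult.commute)
  then have tail: "fps_nth (euler_egf * (1 - fps_cosh) ^ Suc n) (2 * n) = 0"
    by (intro nth_less_subdegree_zero) simp
  have "euler_number (2 * n) = fps_nth euler_egf (2 * n) * fact (2 * n)"
    by (simp add: euler_egf_def)
  also have "fps_nth euler_egf (2 * n) = fps_nth ((\<Sum>k\<le>n. (1 - fps_cosh) ^ k)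
      + euler_egf * (1 - fps_cosh) ^ Suc n) (2 * n)"
    using inverse_geometric[OF euler_egf_times_cosh, of n] by (rule arg_cong)
  also have "\<dots> = (\<Sum>k\<le>n. fps_nth ((1 - fps_cosh) ^ k) (2 * n))"
    unfolding fps_add_nth tail by (simp add: fps_sum_nth)
  also have "\<dots> = (\<Sum>k = 1..n. fps_nth ((1 - fps_cosh) ^ k) (2 * n))"
    using assms by (intro sum.mono_neutral_right) (auto simp: not_less_eq_eq)
  finally show ?thesis
    by (simp only: sum_distrib_right nth_one_minus_cosh_power)
qed

end
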